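(* Let $m,n\ge 1$, let $\mathbf{A}$ be a complex $m\times n$ matrix of full rank (that is, of rank $\min(m,n)$), and let $\mathbf{\Theta}=\mathbf{v}\mathbf{u}^T$ be an $m\times n$ rank-one angle matrix, where $\mathbf{v} = (e^{j\theta_i})\in\mathbb{C}^m$ and $\mathbf{u} = (e^{j\phi_i})\in\mathbb{C}^n$ with all $\theta_i,\phi_i\in\mathbb{R}$. Then the Moore–Penrose inverse of $\mathbf{A}\circ\mathbf{\Theta}$ is $$(\mathbf{A}\circ\mathbf{\Theta})^+ = \mathbf{A}^+\circ\mathbf{\Theta}^H = \begin{cases} \big((\mathbf{A}^H\mathbf{A})^{-1}\mathbf{A}^H\big)\circ\mathbf{\Theta}^H, & m>n;\\ \mathbf{A}^{-1}\circ\mathbf{\Theta}^H, & m=n;\\ \big(\mathbf{A}^H(\mathbf{A}\mathbf{A}^H)^{-1}\big)\circ\mathbf{\Theta}^H, & m<n.\end{cases}$$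
   Context: Here $j$ in exponents denotes the imaginary unit. For two matrices $\mathbf{A}=(a_{ij})$, $\mathbf{B}=(b_{ij})$ of the same size, the Hadamard product is the entrywise product $\mathbf{A}\circ\mathbf{B}=(a_{ij}b_{ij})$. $\mathbf{A}^T$ denotes the transpose and $\mathbf{A}^H$ the conjugate transpose. $\mathbf{A}^+$ denotes the Moore–Penrose inverse (pseudoinverse) of $\mathbf{A}$. An angle vector is a column vector of the form $(e^{j\theta_i})$ with all $\theta_i$ real; given angle vectors $\mathbf{v}=(e^{j\theta_i})\in\mathbb{C}^m$ and $\mathbf{u}=(e^{j\phi_i})\in\mathbb{C}^n$, the $m\times n$ rank-one angle matrix they define is $\mathbf{\Theta}=\mathbf{v}\mathbf{u}^T$, whose $(i,k)$ entry is $e^{j(\theta_i+\phi_k)}$. *)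

theory Defs
  imports
    Complex_Main
    "Jordan_Normal_Form.Gauss_Jordan_Elimination"
    "Jordan_Normal_Form.Schur_Decomposition"
    "Jordan_Normal_Form.DL_Rank"
begin

definition hadamard_prod :: "complex mat \<Rightarrow> complex mat \<Rightarrow> complex mat" (infixl "\<circ>\<^sub>H" 70)
  where "A \<circ>\<^sub>H B = mat (dim_row A) (dim_col A) (\<lambda>(i, k). A $$ (i, k) * B $$ (i, k))"

definition angle_vec :: "nat \<Rightarrow> (nat \<Rightarrow> real) \<Rightarrow> complex vec"
  where "angle_vec d \<theta> = vec d (\<lambda>i. exp (\<i> * complex_of_real (\<theta> i)))"

text \<open>The product \<open>v u\<^sup>T\<close> of a column vector and a row vector.\<close>

definition outer_prod :: "complex vec \<Rightarrow> complex vec \<Rightarrow> complex mat"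
  where "outer_prod v u = mat_of_cols (dim_vec v) [v] * mat_of_rows (dim_vec u) [u]"

text \<open>Meaningful only for invertible \<open>A\<close>; otherwise \<open>mat_inverse A\<close> is \<open>None\<close>.\<close>

definition mat_inv :: "complex mat \<Rightarrow> complex mat"
  where "mat_inv A = the (mat_inverse A)"

text \<open>The four Penrose conditions; \<open>mat_adjoint\<close> is the conjugate transpose.\<close>

definition is_mp_inverse :: "complex mat \<Rightarrow> complex mat \<Rightarrow> bool"
  where "is_mp_inverse A X \<longleftrightarrow>
    X \<in> carrier_mat (dim_col A) (dim_row A) \<and>
    A * X * A = A \<and>
    X * A * X = X \<and>
    mat_adjoint (A * X) = A * X \<and>
    mat_adjoint (X * A) = X * A"

definition mp_inverse :: "complex mat \<Rightarrow> complex mat"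
  where "mp_inverse A = (THE X. is_mp_inverse A X)"

lemma mat_adjoint_dim [simp]:
  "dim_row (mat_adjoint A) = dim_col A" "dim_col (mat_adjoint A) = dim_row A"
  by (simp_all add: mat_adjoint_def)

lemma mat_adjoint_index:
  fixes A :: "complex mat"
  assumes "i < dim_col A" "k < dim_row A"
  shows "mat_adjoint A $$ (i, k) = cnj (A $$ (k, i))"
  using assms by (simp add: mat_adjoint_def mat_of_rows_index)

lemma mat_adjoint_mult:
  fixes A B :: "complex mat"
  assumes "dim_col A = dim_row B"
  shows "mat_adjoint (A * B) = mat_adjoint B * mat_adjoint A"
  using assms
  by (intro eq_matI)
     (auto simp: mat_adjoint_index scalar_prod_def cnj_sum mult.commute intro!: sum.cong)

lemma is_mp_inverse_unique:
  assumes X: "is_mp_inverse A X" and Y: "is_mp_inverse A Y"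
  shows "X = Y"
proof -
  define m n where "m = dim_row A" and "n = dim_col A"
  have cA: "A \<in> carrier_mat m n" by (simp add: m_def n_def)
  have cX: "X \<in> carrier_mat n m" and cY: "Y \<in> carrier_mat n m"
    using X Y by (simp_all add: is_mp_inverse_def m_def n_def)
  note c = cA cX cY
  have x: "A * X * A = A" "X * A * X = X" "mat_adjoint (A * X) = A * X" "mat_adjoint (X * A) = X * A"
    and y: "A * Y * A = A" "Y * A * Y = Y" "mat_adjoint (A * Y) = A * Y" "mat_adjoint (Y * A) = Y * A"
    using X Y by (simp_all add: is_mp_inverse_def)
  have "A * X = (A * Y * A) * X" by (simp add: y)
  also have "\<dots> = (A * Y) * (A * X)"
    by (rule assoc_mult_mat[of _ m m _ n _ m]) (use c in auto)
  also have "\<dots> = mat_adjoint ((A * X) * (A * Y))"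
    using c by (subst mat_adjoint_mult) (auto simp: x y)
  also have "(A * X) * (A * Y) = A * X * A * Y"
    by (rule assoc_mult_mat[of _ m m _ n _ m, symmetric]) (use c in auto)
  finally have 1: "A * X = A * Y" by (simp add: x y)
  have "X * A = X * (A * Y * A)" by (simp add: y)
  also have "\<dots> = X * (A * (Y * A))"
    by (subst assoc_mult_mat[of A m n Y m A n]) (use c in auto)
  also have "\<dots> = (X * A) * (Y * A)"
    by (rule assoc_mult_mat[of _ n m _ n _ n, symmetric]) (use c in auto)
  also have "\<dots> = mat_adjoint ((Y * A) * (X * A))"
    using c by (subst mat_adjoint_mult) (auto simp: x y)
  also have "(Y * A) * (X * A) = Y * (A * (X * A))"
    by (rule assoc_mult_mat[of _ n m _ n _ n]) (use c in auto)
  also have "A * (X * A) = A * X * A"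
    by (rule assoc_mult_mat[of _ m n _ m _ n, symmetric]) (use c in auto)
  finally have 2: "X * A = Y * A" by (simp add: x y)
  have "X = X * A * X" by (simp add: x)
  also have "\<dots> = Y * A * X" by (simp add: 2)
  also have "\<dots> = Y * (A * X)"
    by (rule assoc_mult_mat[of _ n m _ n _ m]) (use c in auto)
  also have "\<dots> = Y * (A * Y)" by (simp add: 1)
  also have "\<dots> = Y * A * Y"
    by (rule assoc_mult_mat[of _ n m _ n _ m, symmetric]) (use c in auto)
  finally show ?thesis by (simp add: y)
qed

lemma mp_inverse_eqI: "is_mp_inverse A X \<Longrightarrow> mp_inverse A = X"
  unfolding mp_inverse_def by (rule the_equality) (auto dest: is_mp_inverse_unique)

end

theory Submission
  imports Defs
begin

text \<open>
  Since \<open>\<bar>v\<^sub>i\<bar> = \<bar>u\<^sub>k\<bar> = 1\<close>, Hadamard multiplication by \<open>v u\<^sup>T\<close> is multiplication by unitary diagonal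
  matrices on both sides. Hence, if \<open>X\<close> satisfies the Penrose conditions for \<open>A\<close>, then
  \<open>X \<circ> \<Theta>\<^sup>H\<close> satisfies them for \<open>A \<circ> \<Theta>\<close>. For \<open>A\<close> of full rank one of the Gram matrices
  \<open>A\<^sup>H A\<close>, \<open>A A\<^sup>H\<close> is invertible, which gives \<open>X\<close> explicitly.
\<close>

section \<open>Hadamard products with rank-one matrices\<close>

lemma outer_prod_dim [simp]:
  "dim_row (outer_prod v u) = dim_vec v" "dim_col (outer_prod v u) = dim_vec u"
  by (simp_all add: outer_prod_def)

lemma outer_prod_index [simp]:
  "i < dim_vec v \<Longrightarrow> k < dim_vec u \<Longrightarrow> outer_prod v u $$ (i, k) = v $ i * u $ k"
  by (simp add: outer_prod_def scalar_prod_def mat_of_cols_index mat_of_rows_index)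

lemma hadamard_prod_dim [simp]:
  "dim_row (A \<circ>\<^sub>H B) = dim_row A" "dim_col (A \<circ>\<^sub>H B) = dim_col A"
  by (simp_all add: hadamard_prod_def)

lemma hadamard_prod_index [simp]:
  "i < dim_row A \<Longrightarrow> k < dim_col A \<Longrightarrow> (A \<circ>\<^sub>H B) $$ (i, k) = A $$ (i, k) * B $$ (i, k)"
  by (simp add: hadamard_prod_def)

lemma mat_adjoint_outer_prod:
  "mat_adjoint (outer_prod v u) = outer_prod (conjugate u) (conjugate v)"
  by (rule eq_matI) (auto simp: mat_adjoint_index)

lemma mat_adjoint_hadamard_prod:
  assumes "dim_row A = dim_row B" "dim_col A = dim_col B"
  shows "mat_adjoint (A \<circ>\<^sub>H B) = mat_adjoint A \<circ>\<^sub>H mat_adjoint B"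
  using assms by (intro eq_matI) (auto simp: mat_adjoint_index)

text \<open>In the sum over the inner index \<open>k\<close> the phases \<open>u $ k\<close> and
  \<open>cnj (u $ k)\<close> multiply to 1, while the outer factor \<open>v $ i * w $ j\<close> does
  not depend on \<open>k\<close> and comes out of the sum.\<close>

lemma hadamard_prod_outer_mult:
  assumes A: "A \<in> carrier_mat (dim_vec v) (dim_vec u)"
    and B: "B \<in> carrier_mat (dim_vec u) (dim_vec w)"
    and u: "\<And>k. k < dim_vec u \<Longrightarrow> cmod (u $ k) = 1"
  shows "(A \<circ>\<^sub>H outer_prod v u) * (B \<circ>\<^sub>H outer_prod (conjugate u) w) = (A * B) \<circ>\<^sub>H outer_prod v w"
proof (rule eq_matI, goal_cases)
  case (1 i j)
  have "u $ k * cnj (u $ k) = 1" if "k < dim_vec u" for k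
    using u[OF that] by (simp flip: complex_norm_square)
  hence cancel: "A $$ (i, k) * (v $ i * u $ k) * (B $$ (k, j) * (cnj (u $ k) * w $ j)) =
      A $$ (i, k) * B $$ (k, j) * (v $ i * w $ j)" if "k < dim_vec u" for k
    using that by (simp add: mult.assoc mult.left_commute)
  from 1 A B show ?case
    by (simp add: scalar_prod_def sum_distrib_right cancel)
qed (use A B in auto)

lemma is_mp_inverse_hadamard_prod:
  assumes AX: "is_mp_inverse A X"
    and A: "A \<in> carrier_mat (dim_vec v) (dim_vec u)"
    and v: "\<And>i. i < dim_vec v \<Longrightarrow> cmod (v $ i) = 1"
    and u: "\<And>k. k < dim_vec u \<Longrightarrow> cmod (u $ k) = 1"
  shows "is_mp_inverse (A \<circ>\<^sub>H outer_prod v u) (X \<circ>\<^sub>H mat_adjoint (outer_prod v u))"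
proof -
  from AX A have X: "X \<in> carrier_mat (dim_vec u) (dim_vec v)"
    by (auto simp: is_mp_inverse_def)
  let ?B = "A \<circ>\<^sub>H outer_prod v u"
  let ?Y = "X \<circ>\<^sub>H outer_prod (conjugate u) (conjugate v)"
  have BY: "?B * ?Y = (A * X) \<circ>\<^sub>H outer_prod v (conjugate v)"
    by (rule hadamard_prod_outer_mult) (use A X u in auto)
  \<comment> \<open>Here the inner phases are those of \<open>conjugate v\<close>, so it is the
    unimodularity of \<open>v\<close> that is used.\<close>
  have YB: "?Y * ?B = (X * A) \<circ>\<^sub>H outer_prod (conjugate u) u"
    using hadamard_prod_outer_mult[of X "conjugate u" "conjugate v" A u] A X v by auto
  have "?B * ?Y * ?B = (A * X * A) \<circ>\<^sub>H outer_prod v u"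
    unfolding BY using hadamard_prod_outer_mult[of "A * X" v "conjugate v" A u] A X v by auto
  moreover have "?Y * ?B * ?Y = (X * A * X) \<circ>\<^sub>H outer_prod (conjugate u) (conjugate v)"
    unfolding YB by (rule hadamard_prod_outer_mult) (use A X u in auto)
  \<comment> \<open>The phase matrices in \<open>BY\<close> and \<open>YB\<close> have the form w
    w^H and are therefore Hermitian.\<close>
  moreover have "mat_adjoint (?B * ?Y) = ?B * ?Y" "mat_adjoint (?Y * ?B) = ?Y * ?B"
    unfolding BY YB using AX A X
    by (simp_all add: mat_adjoint_hadamard_prod mat_adjoint_outer_prod is_mp_inverse_def)
  ultimately show ?thesis
    using AX A X by (auto simp: is_mp_inverse_def mat_adjoint_outer_prod)
qed

section \<open>Invertible matrices and Gram matrices\<close>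

lemma mat_adjoint_adjoint [simp]: "mat_adjoint (mat_adjoint A) = (A :: complex mat)"
  by (rule eq_matI) (auto simp: mat_adjoint_index)

lemma mat_adjoint_carrier [simp]:
  "A \<in> carrier_mat m n \<Longrightarrow> mat_adjoint A \<in> carrier_mat n m"
  by auto

lemma mat_adjoint_one [simp]: "mat_adjoint (1\<^sub>m n) = (1\<^sub>m n :: complex mat)"
  by (rule eq_matI) (auto simp: mat_adjoint_index)

lemma mat_inv:
  assumes A: "A \<in> carrier_mat n n" and det: "det A \<noteq> 0"
  shows "mat_inv A \<in> carrier_mat n n" "A * mat_inv A = 1\<^sub>m n" "mat_inv A * A = 1\<^sub>m n"
proof -
  have "mat_inverse A \<noteq> None"
    using det_non_zero_imp_unit[OF A det, of n] mat_inverse(1)[OF A, of n] by blast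
  then obtain B where "mat_inverse A = Some B" by blast
  with mat_inverse(2)[OF A this] show "mat_inv A \<in> carrier_mat n n"
    "A * mat_inv A = 1\<^sub>m n" "mat_inv A * A = 1\<^sub>m n"
    by (auto simp: mat_inv_def)
qed

text \<open>The adjoint of the inverse is a left inverse of \<open>A\<close>, and a left inverse
  coincides with a right inverse.\<close>

lemma mat_adjoint_mat_inv:
  assumes A: "A \<in> carrier_mat n n" and det: "det A \<noteq> 0" and herm: "mat_adjoint A = A"
  shows "mat_adjoint (mat_inv A) = mat_inv A"
proof -
  note inv = mat_inv[OF A det]
  have left: "mat_adjoint (mat_inv A) * A = 1\<^sub>m n"
    using inv A herm mat_adjoint_mult[of A "mat_inv A"] by simp
  have "mat_adjoint (mat_inv A) = mat_adjoint (mat_inv A) * (A * mat_inv A)"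
    using inv by auto
  also have "\<dots> = mat_adjoint (mat_inv A) * A * mat_inv A"
    by (rule assoc_mult_mat[symmetric]) (use inv A in auto)
  finally show ?thesis
    using left inv by simp
qed

lemma mult_mat_vec_cscalar_prod:
  fixes A :: "complex mat"
  assumes "A \<in> carrier_mat m n" "x \<in> carrier_vec n" "y \<in> carrier_vec m"
  shows "(A *\<^sub>v x) \<bullet>c y = x \<bullet>c (mat_adjoint A *\<^sub>v y)"
proof -
  have "(A *\<^sub>v x) \<bullet>c y = (\<Sum>i<m. \<Sum>k<n. A $$ (i, k) * x $ k * cnj (y $ i))"
    using assms by (auto simp: scalar_prod_def sum_distrib_right atLeast0LessThan intro!: sum.cong)
  also have "\<dots> = (\<Sum>k<n. \<Sum>i<m. A $$ (i, k) * x $ k * cnj (y $ i))"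
    by (rule sum.swap)
  also have "\<dots> = x \<bullet>c (mat_adjoint A *\<^sub>v y)"
    using assms
    by (auto simp: scalar_prod_def sum_distrib_left atLeast0LessThan mat_adjoint_index mult_ac
        intro!: sum.cong)
  finally show ?thesis .
qed

text \<open>If \<open>x\<close> lies in the kernel of the Gram matrix, then the squared norm of
  \<open>A *\<^sub>v x\<close> is the inner product of \<open>x\<close> with A^H A x = 0;
  injectivity of \<open>A\<close> then gives \<open>x = 0\<close>.\<close>

lemma det_gram_nonzero:
  fixes A :: "complex mat"
  assumes A: "A \<in> carrier_mat m n"
    and inj: "\<And>x. x \<in> carrier_vec n \<Longrightarrow> A *\<^sub>v x = 0\<^sub>v m \<Longrightarrow> x = 0\<^sub>v n"
  shows "det (mat_adjoint A * A) \<noteq> 0"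
proof
  have AA: "mat_adjoint A * A \<in> carrier_mat n n"
    using A by auto
  assume "det (mat_adjoint A * A) = 0"
  then obtain x where x: "x \<in> carrier_vec n" "x \<noteq> 0\<^sub>v n" "mat_adjoint A * A *\<^sub>v x = 0\<^sub>v n"
    using det_0_iff_vec_prod_zero_field[OF AA] by auto
  have Ax: "A *\<^sub>v x \<in> carrier_vec m"
    using A x by auto
  have "mat_adjoint A *\<^sub>v (A *\<^sub>v x) = 0\<^sub>v n"
    using x A assoc_mult_mat_vec[OF mat_adjoint_carrier[OF A] A x(1)] by simp
  hence "(A *\<^sub>v x) \<bullet>c (A *\<^sub>v x) = 0"
    using mult_mat_vec_cscalar_prod[OF A x(1) Ax] x by simp
  hence "A *\<^sub>v x = 0\<^sub>v m"
    using Ax by simp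
  with inj x show False by blast
qed

section \<open>Matrices of full rank\<close>

lemma (in vec_space) full_col_rank_kernel:
  assumes A: "A \<in> carrier_mat n nc" and rank: "rank A = nc"
    and x: "x \<in> carrier_vec nc" "A *\<^sub>v x = 0\<^sub>v n"
  shows "x = 0\<^sub>v nc"
proof -
  obtain S where S: "maximal S (\<lambda>T. T \<subseteq> set (cols A) \<and> lin_indpt T)"
    using maximal_exists_superset[of "set (cols A)" "\<lambda>T. T \<subseteq> set (cols A) \<and> lin_indpt T" "{}"]
    by (auto simp: lin_dep_def)
  \<comment> \<open>Linear independence concerns the set of columns, so repeated columns must be
    excluded first: a maximal independent subset already has \<open>nc\<close> elements.\<close>
  have "nc \<le> card (set (cols A))"
    using rank rank_card_indpt[OF A S] S by (auto simp: maximal_def card_mono)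
  moreover have "card (set (cols A)) \<le> length (cols A)" by (rule card_length)
  ultimately have "distinct (cols A)"
    using A by (intro card_distinct) auto
  with full_rank_lin_indpt[OF A rank] lin_depI[OF A x(1) _ x(2)] show ?thesis
    by blast
qed

text \<open>A maximal independent set of columns has as many elements as the dimension of the space,
  so it is a basis and the columns span.\<close>

lemma (in vec_space) full_row_rank_surj:
  assumes A: "A \<in> carrier_mat n nc" and rank: "rank A = n" and y: "y \<in> carrier_vec n"
  obtains x where "x \<in> carrier_vec nc" "A *\<^sub>v x = y"
proof -
  obtain S where S: "maximal S (\<lambda>T. T \<subseteq> set (cols A) \<and> lin_indpt T)" "finite S"
    using maximal_exists_superset[of "set (cols A)" "\<lambda>T. T \<subseteq> set (cols A) \<and> lin_indpt T" "{}"]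
    by (auto simp: lin_dep_def)
  have sub: "S \<subseteq> set (cols A)" and indpt: "lin_indpt S"
    using S by (auto simp: maximal_def)
  have "S \<subseteq> carrier_vec n"
    using sub cols_dim[of A] A by auto
  moreover have "card S = dim"
    using rank rank_card_indpt[OF A S(1)] dim_is_n by simp
  ultimately have "basis S"
    using dim_li_is_basis[OF fin_dim S(2) _ indpt] by auto
  hence "y \<in> span S"
    using y by (simp add: basis_def)
  hence "y \<in> col_space A"
    using span_is_monotone[OF sub] by (auto simp: col_space_def)
  with that A show thesis
    by (auto simp: col_space_eq)
qed

text \<open>The kernel of the adjoint is orthogonal to the range of \<open>A\<close>, which here is
  the whole space, so \<open>y\<close> is orthogonal to itself.\<close>

lemma full_row_rank_adjoint_kernel:
  fixes A :: "complex mat"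
  assumes A: "A \<in> carrier_mat n nc" and rank: "vec_space.rank n A = n"
    and y: "y \<in> carrier_vec n" "mat_adjoint A *\<^sub>v y = 0\<^sub>v nc"
  shows "y = 0\<^sub>v n"
proof -
  obtain x where x: "x \<in> carrier_vec nc" "A *\<^sub>v x = y"
    using vec_space.full_row_rank_surj[OF A rank y(1)] .
  have "y \<bullet>c y = 0"
    using mult_mat_vec_cscalar_prod[OF A x(1) y(1)] x y by simp
  thus ?thesis
    using y by simp
qed

section \<open>The Moore--Penrose inverse of a matrix of full rank\<close>

lemma is_mp_inverse_mat_inv:
  assumes A: "A \<in> carrier_mat n n" and det: "det A \<noteq> 0"
  shows "is_mp_inverse A (mat_inv A)"
  using mat_inv[OF assms] A by (auto simp: is_mp_inverse_def)

text \<open>The candidate is a left inverse of \<open>A\<close>, which settles every Penrose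
  condition except that A X is Hermitian; that one holds because the inverse of the Gram matrix is
  Hermitian.\<close>

lemma is_mp_inverse_full_col_rank:
  assumes A: "A \<in> carrier_mat m n" and det: "det (mat_adjoint A * A) \<noteq> 0"
  shows "is_mp_inverse A (mat_inv (mat_adjoint A * A) * mat_adjoint A)"
proof -
  let ?H = "mat_adjoint A" and ?G = "mat_inv (mat_adjoint A * A)"
  have H: "?H \<in> carrier_mat n m" using A by simp
  hence HA: "?H * A \<in> carrier_mat n n" using A by (rule mult_carrier_mat)
  note G = mat_inv[OF HA det]
  have herm: "mat_adjoint ?G = ?G"
    by (rule mat_adjoint_mat_inv[OF HA det]) (use A in \<open>simp add: mat_adjoint_mult\<close>)
  let ?X = "?G * ?H"
  have X: "?X \<in> carrier_mat n m" using G H by simp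
  have XA: "?X * A = 1\<^sub>m n"
    using assoc_mult_mat[OF G(1) H A] G by simp
  have "A * ?X * A = A"
    using assoc_mult_mat[OF A X A] XA A by simp
  moreover have "mat_adjoint (A * ?X) = A * ?X"
    using A H G herm assoc_mult_mat[OF A G(1) H] by (simp add: mat_adjoint_mult)
  moreover have "?X * A * ?X = ?X" and "mat_adjoint (?X * A) = ?X * A"
    unfolding XA by (simp_all add: left_mult_one_mat[OF X])
  ultimately show ?thesis
    unfolding is_mp_inverse_def carrier_matD[OF A] using X by blast
qed

text \<open>Taking adjoints reverses products, so the two Hermitian conditions change places. This
  reduces full row rank to full column rank.\<close>

lemma is_mp_inverse_adjoint:
  assumes "is_mp_inverse A X"
  shows "is_mp_inverse (mat_adjoint A) (mat_adjoint X)"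
proof -
  define m n where "m = dim_row A" and "n = dim_col A"
  have A: "A \<in> carrier_mat m n" by (simp add: m_def n_def)
  have X: "X \<in> carrier_mat n m" using assms by (simp add: is_mp_inverse_def m_def n_def)
  have "mat_adjoint A * mat_adjoint X * mat_adjoint A = mat_adjoint (A * X * A)"
    using A X by (simp add: mat_adjoint_mult assoc_mult_mat[of _ n m _ n _ m])
  moreover have "mat_adjoint X * mat_adjoint A * mat_adjoint X = mat_adjoint (X * A * X)"
    using A X by (simp add: mat_adjoint_mult assoc_mult_mat[of _ m n _ m _ n])
  moreover have "mat_adjoint A * mat_adjoint X = mat_adjoint (X * A)"
    and "mat_adjoint X * mat_adjoint A = mat_adjoint (A * X)"
    using A X by (simp_all add: mat_adjoint_mult)
  ultimately show ?thesis
    using assms A X by (simp add: is_mp_inverse_def)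
qed

lemma is_mp_inverse_full_row_rank:
  assumes A: "A \<in> carrier_mat m n" and det: "det (A * mat_adjoint A) \<noteq> 0"
  shows "is_mp_inverse A (mat_adjoint A * mat_inv (A * mat_adjoint A))"
proof -
  let ?K = "A * mat_adjoint A"
  have K: "?K \<in> carrier_mat m m" using A by auto
  have "mat_adjoint (mat_inv ?K) = mat_inv ?K"
    by (rule mat_adjoint_mat_inv[OF K det]) (use A in \<open>simp add: mat_adjoint_mult\<close>)
  thus ?thesis
    \<comment> \<open>The Gram matrix of \<open>mat_adjoint A\<close> is \<open>?K\<close>; the
      adjoint of its pseudoinverse is the claimed formula.\<close>
    using is_mp_inverse_adjoint[OF is_mp_inverse_full_col_rank[of "mat_adjoint A" n m]] A det
      mat_inv(1)[OF K det]
    by (simp add: mat_adjoint_mult)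
qed

theorem theorem7:
  fixes m n :: nat and A \<Theta> :: "complex mat" and v u :: "complex vec"
    and \<theta> \<phi> :: "nat \<Rightarrow> real"
  assumes "m \<ge> 1" and "n \<ge> 1"
    and "A \<in> carrier_mat m n"
    and "vec_space.rank m A = min m n"
    and "v = angle_vec m \<theta>" and "u = angle_vec n \<phi>"
    and "\<Theta> = outer_prod v u"
  shows "mp_inverse (A \<circ>\<^sub>H \<Theta>) = mp_inverse A \<circ>\<^sub>H mat_adjoint \<Theta>
    \<and> mp_inverse A \<circ>\<^sub>H mat_adjoint \<Theta> =
       (if m > n then (mat_inv (mat_adjoint A * A) * mat_adjoint A) \<circ>\<^sub>H mat_adjoint \<Theta>
        else if m = n then mat_inv A \<circ>\<^sub>H mat_adjoint \<Theta>
        else (mat_adjoint A * mat_inv (A * mat_adjoint A)) \<circ>\<^sub>H mat_adjoint \<Theta>)"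
proof -
  note A = \<open>A \<in> carrier_mat m n\<close> and rank = \<open>vec_space.rank m A = min m n\<close>
  \<comment> \<open>Collecting the three formulas in one candidate lets a single check of the
    Penrose conditions yield both equations of the claim.\<close>
  define X where "X = (if m > n then mat_inv (mat_adjoint A * A) * mat_adjoint A
    else if m = n then mat_inv A else mat_adjoint A * mat_inv (A * mat_adjoint A))"
  consider "m > n" | "m = n" | "m < n" by linarith
  hence X: "is_mp_inverse A X"
  proof cases
    case 1
    hence "det (mat_adjoint A * A) \<noteq> 0"
      using rank by (intro det_gram_nonzero[OF A] vec_space.full_col_rank_kernel[OF A]) auto
    with 1 show ?thesis
      using is_mp_inverse_full_col_rank[OF A] by (simp add: X_def)
  next
    case 2
    hence "det A \<noteq> 0"
      using vec_space.det_rank_iff[of A m] A rank by simp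
    with 2 show ?thesis
      using is_mp_inverse_mat_inv[of A m] A by (simp add: X_def)
  next
    case 3
    \<comment> \<open>The double adjoint presents A A^H as the Gram matrix of
      \<open>mat_adjoint A\<close>, whose kernel is trivial by full row rank.\<close>
    hence "det (mat_adjoint (mat_adjoint A) * mat_adjoint A) \<noteq> 0"
      using rank
      by (intro det_gram_nonzero[OF mat_adjoint_carrier[OF A]] full_row_rank_adjoint_kernel[OF A])
        auto
    with 3 show ?thesis
      using is_mp_inverse_full_row_rank[OF A] by (simp add: X_def)
  qed
  have "is_mp_inverse (A \<circ>\<^sub>H \<Theta>) (X \<circ>\<^sub>H mat_adjoint \<Theta>)"
    unfolding \<open>\<Theta> = _\<close> using A
    by (intro is_mp_inverse_hadamard_prod[OF X]) (auto simp: \<open>v = _\<close> \<open>u = _\<close> angle_vec_def)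
  \<comment> \<open>Uniqueness of the Moore-Penrose inverse identifies both pseudoinverses.\<close>
  hence "mp_inverse (A \<circ>\<^sub>H \<Theta>) = X \<circ>\<^sub>H mat_adjoint \<Theta>" and "mp_inverse A = X"
    using X by (auto intro: mp_inverse_eqI)
  thus ?thesis
    by (simp add: X_def)
qed

end
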